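(* Let $\Omega$ be a convex subset of a Banach space $\mathbb{X}$ and let $(a_n)_{n \in \mathbb{N}}$, $(b_n)_{n \in \mathbb{N}}$ be two sequences in $[0,1]$. Assume that $T_1 \in \mathbf{Ne}_{\alpha_1}(\Omega)$, $T_2 \in \mathbf{Ne}_{\alpha_2}(\Omega)$ have a common fixed point $x^* \in \mathcal{F}(T_1, T_2)$ for some $\alpha_1, \alpha_2 \in (0,1)$. Let $(x_n)$ be the iterative sequence defined by an initial point $x_0\in\Omega$ and $$y_n=(1-a_n)x_n+a_nT_1(x_n),\qquad x_{n+1}=(1-b_n)y_n+b_nT_2(y_n),\quad n\in\mathbb{N}.$$ Then $$\sum_{k=0}^{\infty}(a_k+b_k)=+\infty \implies \lim_{n \to \infty} x_n = x^*.$$ In particular, under the additional assumption that $1-a_k - \alpha_1 a_k>0$ and $1-b_k - \alpha_2 b_k>0$ for all $k \in \mathbb{N}$, $$\sum_{k=0}^{\infty}(a_k+b_k)=+\infty \iff \lim_{n \to \infty} x_n = x^*.$$ Moreover, if there exists $\varepsilon \in (0,1)$ such that $$(a_n) \subset \left[0,\frac{1-\varepsilon}{1+\alpha_1}\right] \quad\text{and}\quad (b_n) \subset \left[0,\frac{1-\varepsilon}{1+\alpha_2}\right],$$ then $$\log \mathcal{R}^{-1}(x_{n+1},x_0,x^* ) \approx \sum_{k=0}^n (a_k+b_k).$$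
   Context: Banach spaces are real; $\mathbb{N}=\{0,1,2,\dots\}$. For $\alpha\in[0,1]$, $\mathbf{Ne}_{\alpha}(\Omega)$ is the set of maps $T:\Omega\to\Omega$ with $\|T(x)-T(y)\|\le\alpha\|x-y\|$ for all $x,y\in\Omega$. $\mathcal{F}(T_1,T_2)$ is the set of common fixed points, i.e. of $x^*\in\Omega$ with $T_1(x^* )=T_2(x^* )=x^*$. For $u,x,p\in\mathbb{X}$, $\mathcal{R}(u,x,p):=\|u-p\|/\|x-p\|$ if $x\neq p$; $\mathcal{R}(u,x,p):=1$ if $u\neq x=p$; $\mathcal{R}(u,x,p):=0$ if $u=x=p$. $\mathcal{R}^{-1}$ denotes the reciprocal $1/\mathcal{R}$. For real sequences, $u_n\approx v_n$ means that there exist constants $c_1,c_2>0$ not depending on $n$ such that $c_1u_n\le v_n\le c_2u_n$ for every $n\in\mathbb{N}$.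
   Formalization: The equivalence and the logarithmic comparison assume x_0 ≠ x*; if x_0 = x* the equivalence fails (take a_n = b_n = 0) and the reciprocal of R(x_{n+1}, x_0, x* ) = 0 is undefined. *)

theory Defs
  imports "HOL-Analysis.Analysis"
begin

text \<open>Self-maps of \<open>\<Omega>\<close> are represented by total functions on the ambient space, of which
  only the values on \<open>\<Omega>\<close> matter.\<close>

definition Ne :: "real \<Rightarrow> 'a::real_normed_vector set \<Rightarrow> ('a \<Rightarrow> 'a) set" where
  "Ne \<alpha> \<Omega> = {T. T \<in> \<Omega> \<rightarrow> \<Omega> \<and> (\<forall>x\<in>\<Omega>. \<forall>y\<in>\<Omega>. norm (T x - T y) \<le> \<alpha> * norm (x - y))}"

definition common_fixpoints :: "'a set \<Rightarrow> ('a \<Rightarrow> 'a) \<Rightarrow> ('a \<Rightarrow> 'a) \<Rightarrow> 'a set" where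
  "common_fixpoints \<Omega> T\<^sub>1 T\<^sub>2 = {x \<in> \<Omega>. T\<^sub>1 x = x \<and> T\<^sub>2 x = x}"

definition ratio :: "'a::real_normed_vector \<Rightarrow> 'a \<Rightarrow> 'a \<Rightarrow> real" where
  "ratio u x p =
    (if x \<noteq> p then norm (u - p) / norm (x - p) else if u \<noteq> x then 1 else 0)"

definition comparable :: "(nat \<Rightarrow> real) \<Rightarrow> (nat \<Rightarrow> real) \<Rightarrow> bool" where
  "comparable u v \<longleftrightarrow> (\<exists>c\<^sub>1>0. \<exists>c\<^sub>2>0. \<forall>n. c\<^sub>1 * u n \<le> v n \<and> v n \<le> c\<^sub>2 * u n)"

end

theory Submission
  imports Defs
begin

text \<open>Put \<open>d\<^sub>n = \<parallel>x\<^sub>n - x\<^sup>*\<parallel>\<close> and \<open>s\<^sub>n = a\<^sub>n + b\<^sub>n\<close>. Averaging a point with weight \<open>t\<close> towards its image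
  under an \<open>\<alpha>\<close>-contraction multiplies the distance to the fixed point by a factor between
  \<open>1 - (1 + \<alpha>)t\<close> and \<open>1 - (1 - \<alpha>)t\<close>. The upper factor is at most \<open>exp (-(1 - \<alpha>)t)\<close>, and the lower
  one is at least \<open>exp (-(1 + \<alpha>)t/\<epsilon>)\<close> as soon as \<open>(1 + \<alpha>)t \<le> 1 - \<epsilon>\<close>. So \<open>ln (d\<^sub>0/d\<^sub>n\<^sub>+\<^sub>1)\<close> lies
  between two multiples of \<open>\<Sum>k\<le>n. s\<^sub>k\<close>. If the series converges, its terms eventually satisfy the
  condition with \<open>\<epsilon> = 1/2\<close>, and then \<open>d\<^sub>n\<close> stays away from \<open>0\<close> because no factor vanishes.\<close>

lemma Ne_average_in:
  assumes "convex \<Omega>" "T \<in> Ne \<alpha> \<Omega>" "z \<in> \<Omega>" "t \<in> {0..1}"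
  shows "(1 - t) *\<^sub>R z + t *\<^sub>R T z \<in> \<Omega>"
  using assms by (intro convexD) (auto simp: Ne_def)

text \<open>The vector \<open>w - p\<close> averages \<open>z - p\<close> and \<open>T z - p\<close>
  with weights \<open>1 - t\<close> and \<open>t\<close>, and the latter is at most \<alpha> times
  as long as the former because \<open>T\<close> fixes \<open>p\<close>. The two bounds are then the
  triangle inequality and its reverse.\<close>

lemma Ne_average_bounds:
  fixes T :: "'a::real_normed_vector \<Rightarrow> 'a"
  assumes T: "T \<in> Ne \<alpha> \<Omega>" and z: "z \<in> \<Omega>" and p: "p \<in> \<Omega>" "T p = p" and t: "t \<in> {0..1}"
  defines "w \<equiv> (1 - t) *\<^sub>R z + t *\<^sub>R T z"
  shows "norm (w - p) \<le> (1 - (1 - \<alpha>) * t) * norm (z - p)"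
    and "(1 - (1 + \<alpha>) * t) * norm (z - p) \<le> norm (w - p)"
proof -
  have w: "w - p = (1 - t) *\<^sub>R (z - p) + t *\<^sub>R (T z - p)"
    by (simp add: w_def algebra_simps)
  have "norm (T z - p) \<le> \<alpha> * norm (z - p)"
    using T z p unfolding Ne_def by force
  then have image: "t * norm (T z - p) \<le> t * (\<alpha> * norm (z - p))"
    using t by (intro mult_left_mono) auto
  have "norm (w - p) \<le> (1 - t) * norm (z - p) + t * norm (T z - p)"
    using norm_triangle_ineq[of "(1 - t) *\<^sub>R (z - p)" "t *\<^sub>R (T z - p)"] t by (simp add: w)
  with image show "norm (w - p) \<le> (1 - (1 - \<alpha>) * t) * norm (z - p)"
    by (simp add: algebra_simps)
  have "(1 - t) * norm (z - p) - t * norm (T z - p) \<le> norm (w - p)"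
    using norm_diff_ineq[of "(1 - t) *\<^sub>R (z - p)" "t *\<^sub>R (T z - p)"] t by (simp add: w)
  with image show "(1 - (1 + \<alpha>) * t) * norm (z - p) \<le> norm (w - p)"
    by (simp add: algebra_simps)
qed

text \<open>By 1 + u \<le> exp u at u = t/\<epsilon>, it is enough that (1 - t)(1 + t/\<epsilon>)
  \<ge> 1, and this product equals 1 + t(1 - \<epsilon> - t)/\<epsilon>.\<close>

lemma exp_le_one_minus:
  fixes t \<epsilon> :: real
  assumes "0 \<le> t" "t \<le> 1 - \<epsilon>" "0 < \<epsilon>"
  shows "exp (- t / \<epsilon>) \<le> 1 - t"
proof -
  have "1 \<le> (1 - t) * (1 + t / \<epsilon>)"
    using mult_nonneg_nonneg[of t "1 - \<epsilon> - t"] assms by (simp add: field_simps)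
  also have "\<dots> \<le> (1 - t) * exp (t / \<epsilon>)"
    using assms by (intro mult_left_mono exp_ge_add_one_self) auto
  finally show ?thesis
    by (simp add: exp_minus field_simps)
qed

text \<open>The recursion telescopes, since only the nonnegative exponential is multiplied into the
  induction hypothesis. No sign is imposed on \<open>d\<close>, so that the bound also applies to
  \<open>- d\<close> and yields the reverse estimate.\<close>

lemma exp_sum_upper_bound:
  fixes d s :: "nat \<Rightarrow> real"
  assumes "\<And>n. d (Suc n) \<le> exp (- m * s n) * d n"
  shows "d n \<le> exp (- m * (\<Sum>k<n. s k)) * d 0"
proof (induction n)
  case (Suc n)
  have "d (Suc n) \<le> exp (- m * s n) * (exp (- m * (\<Sum>k<n. s k)) * d 0)"
    using assms[of n] Suc by (meson exp_ge_zero mult_left_mono order_trans)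
  then show ?case
    by (simp only: sum.lessThan_Suc distrib_left exp_add mult_ac)
qed simp

lemma exp_sum_lower_bound:
  fixes d s :: "nat \<Rightarrow> real"
  assumes "\<And>n. exp (- m * s n) * d n \<le> d (Suc n)"
  shows "exp (- m * (\<Sum>k<n. s k)) * d 0 \<le> d n"
  using exp_sum_upper_bound[of "\<lambda>n. - d n" m s n] assms by simp

text \<open>Failure of divergence gives a constant \<open>C\<close> that exceeds partial sums at
  arbitrarily late indices; monotonicity carries this bound back to every earlier index.\<close>

lemma summable_if_not_at_top:
  fixes s :: "nat \<Rightarrow> real"
  assumes nonneg: "\<And>n. 0 \<le> s n" and not_top: "\<not> filterlim (\<lambda>n. \<Sum>k\<le>n. s k) at_top sequentially"
  shows "summable s"
proof -
  obtain C where C: "\<And>N. \<exists>n\<ge>N. (\<Sum>k\<le>n. s k) < C"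
    using not_top unfolding filterlim_at_top eventually_sequentially by (meson not_le)
  have "(\<Sum>k\<le>N. s k) \<le> C" for N
  proof -
    obtain n where "n \<ge> N" "(\<Sum>k\<le>n. s k) < C"
      using C by blast
    moreover have "(\<Sum>k\<le>N. s k) \<le> (\<Sum>k\<le>n. s k)"
      using \<open>n \<ge> N\<close> nonneg by (intro sum_mono2) auto
    ultimately show ?thesis by simp
  qed
  then show ?thesis
    using bounded_imp_summable nonneg by blast
qed

text \<open>The last two claims ask for \<open>x 0 \<noteq> xstar\<close>: from
  \<open>x 0 = xstar\<close> the sequence is constant, hence convergent whatever the series does,
  and \<open>ratio\<close> is 0, so that its reciprocal is a mere default value.\<close>

theorem theorem4p3:
  fixes \<Omega> :: "'a::banach set"
    and a b :: "nat \<Rightarrow> real"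
    and \<alpha>\<^sub>1 \<alpha>\<^sub>2 :: real
    and T\<^sub>1 T\<^sub>2 :: "'a \<Rightarrow> 'a"
    and xstar :: 'a
    and x y :: "nat \<Rightarrow> 'a"
  assumes "convex \<Omega>"
    and "\<And>n. a n \<in> {0..1}"
    and "\<And>n. b n \<in> {0..1}"
    and "\<alpha>\<^sub>1 \<in> {0<..<1}"
    and "\<alpha>\<^sub>2 \<in> {0<..<1}"
    and "T\<^sub>1 \<in> Ne \<alpha>\<^sub>1 \<Omega>"
    and "T\<^sub>2 \<in> Ne \<alpha>\<^sub>2 \<Omega>"
    and "xstar \<in> common_fixpoints \<Omega> T\<^sub>1 T\<^sub>2"
    and "x 0 \<in> \<Omega>"
    and "\<And>n. y n = (1 - a n) *\<^sub>R x n + a n *\<^sub>R T\<^sub>1 (x n)"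
    and "\<And>n. x (Suc n) = (1 - b n) *\<^sub>R y n + b n *\<^sub>R T\<^sub>2 (y n)"
  shows "(filterlim (\<lambda>n. \<Sum>k\<le>n. a k + b k) at_top sequentially \<longrightarrow> x \<longlonglongrightarrow> xstar)
    \<and> (x 0 \<noteq> xstar \<and> (\<forall>k. 1 - a k - \<alpha>\<^sub>1 * a k > 0 \<and> 1 - b k - \<alpha>\<^sub>2 * b k > 0) \<longrightarrow>
        (filterlim (\<lambda>n. \<Sum>k\<le>n. a k + b k) at_top sequentially \<longleftrightarrow> x \<longlonglongrightarrow> xstar))
    \<and> (x 0 \<noteq> xstar \<and> (\<exists>\<epsilon>\<in>{0<..<1}. range a \<subseteq> {0..(1 - \<epsilon>) / (1 + \<alpha>\<^sub>1)}
                              \<and> range b \<subseteq> {0..(1 - \<epsilon>) / (1 + \<alpha>\<^sub>2)}) \<longrightarrow>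
        comparable (\<lambda>n. ln (1 / ratio (x (Suc n)) (x 0) xstar)) (\<lambda>n. \<Sum>k\<le>n. a k + b k))"
proof -
  define d where "d n = norm (x n - xstar)" for n
  define s where "s n = a n + b n" for n
  \<comment> \<open>The weaker of the two contraction rates, so that one exponent governs both
    half-steps.\<close>
  define m where "m = min (1 - \<alpha>\<^sub>1) (1 - \<alpha>\<^sub>2)"
  note convex = assms(1) and a = assms(2) and b = assms(3) and \<alpha>\<^sub>1 = assms(4) and \<alpha>\<^sub>2 = assms(5)
    and T\<^sub>1 = assms(6) and T\<^sub>2 = assms(7) and y = assms(10) and xSuc = assms(11)
  have p: "xstar \<in> \<Omega>" "T\<^sub>1 xstar = xstar" "T\<^sub>2 xstar = xstar"
    using assms(8) by (auto simp: common_fixpoints_def)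
  have m: "0 < m" "m \<le> 1 - \<alpha>\<^sub>1" "m \<le> 1 - \<alpha>\<^sub>2"
    using \<alpha>\<^sub>1 \<alpha>\<^sub>2 by (auto simp: m_def)
  have a': "0 \<le> a n" "a n \<le> 1" and b': "0 \<le> b n" "b n \<le> 1" for n
    using a[of n] b[of n] by auto
  have \<alpha>': "0 < \<alpha>\<^sub>1" "\<alpha>\<^sub>1 < 1" "0 < \<alpha>\<^sub>2" "\<alpha>\<^sub>2 < 1"
    using \<alpha>\<^sub>1 \<alpha>\<^sub>2 by auto
  have s_nonneg: "0 \<le> s n" for n
    using a'[of n] b'[of n] by (simp add: s_def)
  have d_nonneg: "0 \<le> d n" for n
    by (simp add: d_def)
  have x_in: "x n \<in> \<Omega>" for n
  proof (induction n)
    case (Suc n)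
    then show ?case
      using Ne_average_in[OF convex T\<^sub>2 Ne_average_in[OF convex T\<^sub>1 Suc a] b] by (simp only: y xSuc)
  qed (rule assms(9))
  have y_in: "y n \<in> \<Omega>" for n
    using Ne_average_in[OF convex T\<^sub>1 x_in a] by (simp only: y)
  have y_bounds: "norm (y n - xstar) \<le> (1 - (1 - \<alpha>\<^sub>1) * a n) * d n"
    "(1 - (1 + \<alpha>\<^sub>1) * a n) * d n \<le> norm (y n - xstar)" for n
    using Ne_average_bounds[OF T\<^sub>1 x_in p(1,2) a, of n n] by (simp_all only: y d_def)
  have x_bounds: "d (Suc n) \<le> (1 - (1 - \<alpha>\<^sub>2) * b n) * norm (y n - xstar)"
    "(1 - (1 + \<alpha>\<^sub>2) * b n) * norm (y n - xstar) \<le> d (Suc n)" for n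
    using Ne_average_bounds[OF T\<^sub>2 y_in p(1,3) b, of n n] by (simp_all only: xSuc d_def)

  have contraction: "1 - (1 - \<alpha>) * t \<le> exp (- m * t)" if "m \<le> 1 - \<alpha>" "0 \<le> t" for \<alpha> t
    using exp_ge_add_one_self[of "- m * t"] mult_right_mono[OF that] by simp
  have upper_step: "d (Suc n) \<le> exp (- m * s n) * d n" for n
  proof -
    have "norm (y n - xstar) \<le> exp (- m * a n) * d n"
      using y_bounds(1)[of n] mult_right_mono[OF contraction[OF m(2) a'(1)] d_nonneg, of n n]
      by linarith
    moreover have "d (Suc n) \<le> exp (- m * b n) * norm (y n - xstar)"
      using x_bounds(1)[of n]
        mult_right_mono[OF contraction[OF m(3) b'(1)] norm_ge_zero, of n "y n - xstar"]
      by linarith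
    ultimately have "d (Suc n) \<le> exp (- m * b n) * (exp (- m * a n) * d n)"
      by (meson exp_ge_zero mult_left_mono order_trans)
    then show ?thesis
      by (simp only: s_def distrib_left distrib_right exp_add mult_ac)
  qed
  have upper: "d n \<le> exp (- m * (\<Sum>k<n. s k)) * d 0" for n
    using upper_step by (rule exp_sum_upper_bound)

  \<comment> \<open>Replacing 1 + \<alpha> by 2 makes the exponent independent of \<alpha>, so the
    bounds for the two operators combine into one in \<open>s n\<close>.\<close>
  have expansion: "exp (- (2 / \<epsilon>) * t) \<le> 1 - (1 + \<alpha>) * t"
    if "0 < \<epsilon>" "(1 + \<alpha>) * t \<le> 1 - \<epsilon>" "0 \<le> t" "0 < \<alpha>" "\<alpha> < 1" for \<epsilon> \<alpha> t :: real
  proof -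
    have "(1 + \<alpha>) * t \<le> 2 * t"
      using that by (intro mult_right_mono) auto
    then have "exp (- (2 / \<epsilon>) * t) \<le> exp (- ((1 + \<alpha>) * t) / \<epsilon>)"
      using that by (simp add: field_simps)
    also have "\<dots> \<le> 1 - (1 + \<alpha>) * t"
      using that by (intro exp_le_one_minus) auto
    finally show ?thesis .
  qed
  have lower_step: "exp (- (2 / \<epsilon>) * s n) * d n \<le> d (Suc n)"
    if "0 < \<epsilon>" "(1 + \<alpha>\<^sub>1) * a n \<le> 1 - \<epsilon>" "(1 + \<alpha>\<^sub>2) * b n \<le> 1 - \<epsilon>" for \<epsilon> n
  proof -
    have "exp (- (2 / \<epsilon>) * a n) * d n \<le> norm (y n - xstar)"
      using y_bounds(2)[of n] \<alpha>'
        mult_right_mono[OF expansion[OF that(1,2) a'(1)] d_nonneg, of n] by linarith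
    moreover have "exp (- (2 / \<epsilon>) * b n) * norm (y n - xstar) \<le> d (Suc n)"
      using x_bounds(2)[of n] \<alpha>'
        mult_right_mono[OF expansion[OF that(1,3) b'(1)] norm_ge_zero, of "y n - xstar"]
      by linarith
    ultimately have "exp (- (2 / \<epsilon>) * b n) * (exp (- (2 / \<epsilon>) * a n) * d n) \<le> d (Suc n)"
      by (meson exp_ge_zero mult_left_mono order_trans)
    then show ?thesis
      by (simp only: s_def distrib_left distrib_right exp_add mult_ac)
  qed

  have conv: "x \<longlonglongrightarrow> xstar" if "filterlim (\<lambda>n. \<Sum>k\<le>n. s k) at_top sequentially"
  proof -
    \<comment> \<open>The bound \<open>upper\<close> on \<open>d n\<close> involves only the terms
      before \<open>n\<close>, hence the index shift.\<close>
    have "filterlim (\<lambda>n. \<Sum>k<n. s k) at_top sequentially"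
      using that unfolding lessThan_Suc_atMost[symmetric] by (subst (asm) filterlim_sequentially_Suc)
    then have "filterlim (\<lambda>n. m * (\<Sum>k<n. s k)) at_top sequentially"
      using m(1) by (intro filterlim_tendsto_pos_mult_at_top[OF tendsto_const]) auto
    then have "(\<lambda>n. exp (- (m * (\<Sum>k<n. s k)))) \<longlonglongrightarrow> 0"
      by (intro filterlim_compose[OF exp_at_bot]) (simp add: filterlim_uminus_at_bot)
    then have "(\<lambda>n. exp (- m * (\<Sum>k<n. s k)) * d 0) \<longlonglongrightarrow> 0"
      by (simp add: tendsto_mult_left_zero)
    then have "d \<longlonglongrightarrow> 0"
      by (rule tendsto_sandwich[OF _ _ tendsto_const, rotated 2])
        (use upper d_nonneg in auto)
    then show ?thesis
      unfolding d_def by (simp add: LIM_zero_iff tendsto_norm_zero_iff)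
  qed
  have diverges: "filterlim (\<lambda>n. \<Sum>k\<le>n. s k) at_top sequentially"
    if x0: "x 0 \<noteq> xstar" and pos: "\<And>k. 1 - a k - \<alpha>\<^sub>1 * a k > 0" "\<And>k. 1 - b k - \<alpha>\<^sub>2 * b k > 0"
      and lim: "x \<longlonglongrightarrow> xstar"
  proof (rule ccontr)
    assume "\<not> ?thesis"
    with s_nonneg have sm: "summable s"
      by (rule summable_if_not_at_top)
    \<comment> \<open>The strict positivity of both lower factors prevents the sequence from
      reaching \<open>xstar\<close> in finitely many steps, in particular before the tail estimate
      starts.\<close>
    have d_pos: "0 < d n" for n
    proof (induction n)
      case 0
      show ?case using x0 by (simp add: d_def)
    next
      case (Suc n)
      have "0 < (1 - (1 + \<alpha>\<^sub>1) * a n) * d n"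
        using Suc pos(1)[of n] by (intro mult_pos_pos) (auto simp: algebra_simps)
      then have "0 < (1 - (1 + \<alpha>\<^sub>2) * b n) * norm (y n - xstar)"
        using y_bounds(2)[of n] pos(2)[of n] by (intro mult_pos_pos) (auto simp: algebra_simps)
      with x_bounds(2)[of n] show ?case by linarith
    qed
    \<comment> \<open>With 1 + \<alpha> < 2, terms below 1/4 satisfy the condition of
      \<open>lower_step\<close> for \<epsilon> = 1/2, which makes the exponent 2/\<epsilon> =
      4.\<close>
    obtain N where N: "\<And>n. n \<ge> N \<Longrightarrow> s n < 1/4"
      using order_tendstoD(2)[OF summable_LIMSEQ_zero[OF sm], of "1/4"]
      by (auto simp: eventually_sequentially)
    have small: "(1 + \<alpha>) * t \<le> 1 - 1/2" if "0 < \<alpha>" "\<alpha> < 1" "0 \<le> t" "t \<le> 1/4" for \<alpha> t :: real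
      using mult_mono[of "1 + \<alpha>" 2 t "1/4"] that by simp
    have "exp (- 4 * s (n + N)) * d (n + N) \<le> d (Suc n + N)" for n
      using lower_step[of "1/2" "n + N"] N[of "n + N"] a'[of "n + N"] b'[of "n + N"] small \<alpha>'
      by (simp add: s_def)
    then have lower: "exp (- 4 * (\<Sum>k<n. s (k + N))) * d N \<le> d (n + N)" for n
      using exp_sum_lower_bound[of 4 "\<lambda>n. s (n + N)" "\<lambda>n. d (n + N)" n] by simp
    \<comment> \<open>Passing to the full tail sum makes the lower bound independent of
      \<open>n\<close>, so it survives in the limit and contradicts \<open>d_pos\<close>.\<close>
    have "exp (- 4 * (\<Sum>k. s (k + N))) * d N \<le> d (n + N)" for n
    proof -
      have "(\<Sum>k<n. s (k + N)) \<le> (\<Sum>k. s (k + N))"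
        using sm s_nonneg by (intro sum_le_suminf) (auto simp: summable_iff_shift)
      then have "exp (- 4 * (\<Sum>k. s (k + N))) * d N \<le> exp (- 4 * (\<Sum>k<n. s (k + N))) * d N"
        using d_nonneg by (intro mult_right_mono) auto
      with lower[of n] show ?thesis by linarith
    qed
    moreover have "(\<lambda>n. d (n + N)) \<longlonglongrightarrow> 0"
      using lim unfolding d_def by (intro LIMSEQ_ignore_initial_segment tendsto_norm_zero LIM_zero)
    ultimately have "exp (- 4 * (\<Sum>k. s (k + N))) * d N \<le> 0"
      by (intro LIMSEQ_le_const) auto
    with d_pos[of N] show False
      by (simp add: mult_le_0_iff)
  qed
  have compare: "comparable (\<lambda>n. ln (1 / ratio (x (Suc n)) (x 0) xstar)) (\<lambda>n. \<Sum>k\<le>n. s k)"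
    if x0: "x 0 \<noteq> xstar" and \<epsilon>: "0 < \<epsilon>" and ra: "range a \<subseteq> {0..(1 - \<epsilon>) / (1 + \<alpha>\<^sub>1)}"
      and rb: "range b \<subseteq> {0..(1 - \<epsilon>) / (1 + \<alpha>\<^sub>2)}" for \<epsilon>
  proof -
    have d0: "0 < d 0"
      using x0 by (simp add: d_def)
    have "a n \<le> (1 - \<epsilon>) / (1 + \<alpha>\<^sub>1)" "b n \<le> (1 - \<epsilon>) / (1 + \<alpha>\<^sub>2)" for n
      using ra rb by (auto simp: image_subset_iff)
    then have "exp (- (2 / \<epsilon>) * s n) * d n \<le> d (Suc n)" for n
      using \<alpha>' \<epsilon> by (intro lower_step) (simp_all add: field_simps)
    then have lower: "exp (- (2 / \<epsilon>) * (\<Sum>k<n. s k)) * d 0 \<le> d n" for n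
      by (rule exp_sum_lower_bound)
    \<comment> \<open>Positive distances make the logarithm laws used below applicable.\<close>
    have d_pos: "0 < d n" for n
      using lower[of n] d0 by (meson exp_gt_zero less_le_trans mult_pos_pos)
    have log: "ln (1 / ratio (x (Suc n)) (x 0) xstar) = ln (d 0) - ln (d (Suc n))" for n
      using x0 d0 d_pos[of "Suc n"] by (simp add: ratio_def d_def[symmetric] ln_div)
    have "m * (\<Sum>k\<le>n. s k) \<le> ln (d 0) - ln (d (Suc n))" for n
    proof -
      have "ln (d (Suc n)) \<le> ln (exp (- m * (\<Sum>k\<le>n. s k)) * d 0)"
        using upper[of "Suc n"] d_pos[of "Suc n"] by (simp only: lessThan_Suc_atMost ln_mono)
      then show ?thesis
        using d0 by (simp add: ln_mult)
    qed
    moreover have "ln (d 0) - ln (d (Suc n)) \<le> 2 / \<epsilon> * (\<Sum>k\<le>n. s k)" for n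
    proof -
      have "ln (exp (- (2 / \<epsilon>) * (\<Sum>k\<le>n. s k)) * d 0) \<le> ln (d (Suc n))"
        using lower[of "Suc n"] d0 by (intro ln_mono) (simp_all only: lessThan_Suc_atMost exp_gt_zero mult_pos_pos)
      then show ?thesis
        using d0 by (simp add: ln_mult)
    qed
    ultimately show ?thesis
      \<comment> \<open>Here \<open>comparable\<close> scales the logarithm rather than the sum, so
        the constants 2/\<epsilon> and \<open>m\<close> found above enter as reciprocals.\<close>
      unfolding comparable_def log using m(1) \<epsilon>
      by (intro exI[of _ "\<epsilon> / 2"] exI[of _ "1 / m"] conjI allI) (simp_all add: field_simps)
  qed
  show ?thesis
    unfolding s_def[symmetric]
  proof (intro conjI impI)
    assume "x 0 \<noteq> xstar \<and> (\<forall>k. 1 - a k - \<alpha>\<^sub>1 * a k > 0 \<and> 1 - b k - \<alpha>\<^sub>2 * b k > 0)"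
    then show "filterlim (\<lambda>n. \<Sum>k\<le>n. s k) at_top sequentially \<longleftrightarrow> x \<longlonglongrightarrow> xstar"
      using conv diverges by metis
  next
    assume "x 0 \<noteq> xstar \<and> (\<exists>\<epsilon>\<in>{0<..<1}. range a \<subseteq> {0..(1 - \<epsilon>) / (1 + \<alpha>\<^sub>1)}
                              \<and> range b \<subseteq> {0..(1 - \<epsilon>) / (1 + \<alpha>\<^sub>2)})"
    then show "comparable (\<lambda>n. ln (1 / ratio (x (Suc n)) (x 0) xstar)) (\<lambda>n. \<Sum>k\<le>n. s k)"
      using compare by (metis greaterThanLessThan_iff)
  qed (rule conv)
qed

end
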